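(* Let $M \subseteq [\omega]^\omega$ be a large $EL$-open set. Then there is no partition $\mathcal{F}$ of $M$ such that $\mathcal{F}$ is a large partition of $M$ into $NR$-sets, $M$ is $EL$-dense with respect to $\mathcal{F}$, and $\mathcal{F}$ is a Kuratowski partition (i.e. no large $EL$-dense $EL$-open set admits a Kuratowski partition).
   Context: For $a \in [\omega]^{<\omega}$ and $A \in [\omega]^\omega$ let $[a, A] = \{B \in [A]^\omega \colon a \subset B \subseteq a \cup A\}$. The Ellentuck topology on $[\omega]^\omega$ is the topology generated by the sets $[a,A]$; $EL$-open means open in this topology. A set $M \subseteq [\omega]^\omega$ is completely Ramsey ($CR$) if for every $[a, A]$ there is $B \in [A]^\omega$ with $[a, B] \subseteq M$ or $[a, B] \cap M = \emptyset$; it is nowhere Ramsey ($NR$) if for every $[a, A]$ there is $B \in [A]^\omega$ with $[a, B] \cap M = \emptyset$. A set is large if it is not $NR$; a family of sets is large if its union is large. Given a large $EL$-open $M$ and a large partition $\mathcal{F}$ of $M$ into $NR$-sets, $M$ is $EL$-dense (with respect to $\mathcal{F}$) if for every $[a, A]$ such that $M \cap [a, A]$ is large, the family $\{F \in \mathcal{F} \colon F \cap [a, A] \neq \emptyset\}$ is large. A partition $\mathcal{F}$ of $M$ is a Kuratowski partition (in the Ellentuck setting) if for every subfamily $\mathcal{F}' \subseteq \mathcal{F}$ the set $\bigcup \mathcal{F}'$ is a $CR$-set (the $CR$-sets playing the role of sets with the Baire property).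
   Formalization: The basic set [a,A] is taken as all infinite B ⊆ ω with a ⊆ B ⊆ a ∪ A (the standard Ellentuck set) rather than B ∈ [A]^ω; read literally, partitioning [ω]^ω by minimum would refute the claim. *)

theory Defs
  imports "HOL-Analysis.Analysis" "HOL-Library.Disjoint_Sets"
begin

definition inf_subsets :: "nat set \<Rightarrow> nat set set" where
  "inf_subsets A = {B. B \<subseteq> A \<and> infinite B}"

text \<open>The basic sets \<open>[a, A]\<close>, meant for finite \<open>a\<close> and infinite \<open>A\<close>. The members range over
  all infinite sets of naturals: requiring them to be subsets of \<open>A\<close> would make \<open>[a, A]\<close> empty
  unless \<open>a \<subseteq> A\<close>, so that the conditions below would be vacuous for nonempty \<open>a\<close>
  (choose \<open>B\<close> disjoint from \<open>a\<close>). No condition \<open>max a < min A\<close> is imposed.\<close>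

definition ellentuck_basic :: "nat set \<Rightarrow> nat set \<Rightarrow> nat set set" where
  "ellentuck_basic a A = {B \<in> inf_subsets UNIV. a \<subseteq> B \<and> B \<subseteq> a \<union> A}"

definition ellentuck_topology :: "nat set topology" where
  "ellentuck_topology =
     topology_generated_by {ellentuck_basic a A |a A. finite a \<and> infinite A}"

abbreviation EL_open :: "nat set set \<Rightarrow> bool" where
  "EL_open M \<equiv> openin ellentuck_topology M"

definition completely_Ramsey :: "nat set set \<Rightarrow> bool" where
  "completely_Ramsey M \<longleftrightarrow>
     (\<forall>a A. finite a \<and> infinite A \<longrightarrow>
        (\<exists>B \<in> inf_subsets A. ellentuck_basic a B \<subseteq> M \<or> ellentuck_basic a B \<inter> M = {}))"

definition nowhere_Ramsey :: "nat set set \<Rightarrow> bool" where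
  "nowhere_Ramsey M \<longleftrightarrow>
     (\<forall>a A. finite a \<and> infinite A \<longrightarrow>
        (\<exists>B \<in> inf_subsets A. ellentuck_basic a B \<inter> M = {}))"

definition large :: "nat set set \<Rightarrow> bool" where
  "large M \<longleftrightarrow> \<not> nowhere_Ramsey M"

definition large_family :: "nat set set set \<Rightarrow> bool" where
  "large_family \<F> \<longleftrightarrow> large (\<Union>\<F>)"

definition large_NR_partition :: "nat set set \<Rightarrow> nat set set set \<Rightarrow> bool" where
  "large_NR_partition M \<F> \<longleftrightarrow>
     partition_on M \<F> \<and> large_family \<F> \<and> (\<forall>F \<in> \<F>. nowhere_Ramsey F)"

definition EL_dense :: "nat set set \<Rightarrow> nat set set set \<Rightarrow> bool" where
  "EL_dense M \<F> \<longleftrightarrow>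
     (\<forall>a A. finite a \<and> infinite A \<and> large (M \<inter> ellentuck_basic a A) \<longrightarrow>
        large_family {F \<in> \<F>. F \<inter> ellentuck_basic a A \<noteq> {}})"

definition Kuratowski_partition :: "nat set set \<Rightarrow> nat set set set \<Rightarrow> bool" where
  "Kuratowski_partition M \<F> \<longleftrightarrow>
     partition_on M \<F> \<and> (\<forall>\<F>' \<subseteq> \<F>. completely_Ramsey (\<Union>\<F>'))"

end

theory Submission
  imports Defs
begin

text \<open>
  By a fusion argument the \<open>NR\<close>-sets form a \<open>\<sigma>\<close>-ideal. Hence, if \<open>\<F>\<close> is a Kuratowski
  partition of \<open>M\<close> into \<open>NR\<close>-sets and \<open>[a, A] \<subseteq> M\<close>, some subfamily of \<open>\<F>\<close> and its complement
  both have a large union inside \<open>[a, A]\<close>: otherwise the subfamilies with large union would form a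
  \<open>\<sigma>\<close>-complete nonprincipal ultrafilter on \<open>\<F>\<close>, which is impossible since \<open>\<F>\<close> has at most
  continuum many members. As these unions are \<open>CR\<close>, each of them contains a basic subset of
  \<open>[a, A]\<close>. Iterating this along the binary tree shows that every \<open>[a, B]\<close> with \<open>B \<subseteq> A\<close> meets
  continuum many members of \<open>\<F>\<close>. There are only continuum many \<open>B\<close>, so a Bernstein construction
  yields a subfamily whose union and its complement meet all these \<open>[a, B]\<close>, i.e. a union that is
  not \<open>CR\<close>.
\<close>

section \<open>Choice principles\<close>

lemma inj_on_choice_function:
  fixes S :: "'i \<Rightarrow> 'b set"
  assumes "\<And>i. i \<in> I \<Longrightarrow> I \<lesssim> S i"
  shows "\<exists>f. inj_on f I \<and> (\<forall>i\<in>I. f i \<in> S i)"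
proof -
  include cardinal_syntax
  define r where "r = |I|"
  have card: "Card_order r" and field: "Field r = I" and well: "Well_order r"
    unfolding r_def by (rule card_of_Card_order, rule Field_card_of, rule card_of_Well_order)
  have wf: "wf (r - Id)"
    using well by (simp add: well_order_on_def)
  have total: "total_on I r"
    using well field by (simp add: well_order_on_def linear_order_on_def)
  have "\<exists>f. \<forall>i. i \<in> I \<longrightarrow> f i \<in> S i \<and> (\<forall>j. (j, i) \<in> r - Id \<longrightarrow> f j \<noteq> f i)"
  proof (rule dependent_wf_choice[OF wf])
    fix i and f :: "'i \<Rightarrow> 'b"
    show "\<exists>y. i \<in> I \<longrightarrow> y \<in> S i \<and> (\<forall>j. (j, i) \<in> r - Id \<longrightarrow> f j \<noteq> y)"
    proof (cases "i \<in> I")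
      case True
      have "\<not> S i \<subseteq> f ` underS r i"
      proof
        assume "S i \<subseteq> f ` underS r i"
        then have "I \<lesssim> underS r i"
          using assms[OF True] by (meson lepoll_trans subset_image_lepoll)
        then have "|I| \<le>o |underS r i|"
          by (simp add: lepoll_def card_of_ordLeq)
        also have "|underS r i| <o |I|"
          using card_of_underS[OF card] field True by (simp add: r_def)
        finally (ordLeq_ordLess_trans) show False
          using ordLess_irreflexive by blast
      qed
      then show ?thesis
        by (auto simp: underS_def)
    qed simp
  qed auto
  then obtain f where choice: "\<And>i. i \<in> I \<Longrightarrow> f i \<in> S i"
    and fresh: "\<And>i j. i \<in> I \<Longrightarrow> (j, i) \<in> r - Id \<Longrightarrow> f j \<noteq> f i"
    by blast
  have "inj_on f I"
  proof (rule inj_onI, rule ccontr)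
    fix i j assume "i \<in> I" "j \<in> I" "f i = f j" "i \<noteq> j"
    then show False
      using fresh[of i j] fresh[of j i] total by (auto simp: total_on_def)
  qed
  then show ?thesis
    using choice by blast
qed

lemma exists_splitting_set:
  fixes S :: "'i \<Rightarrow> 'b set"
  assumes infinite: "\<And>i. i \<in> I \<Longrightarrow> infinite (S i)" and lepoll: "\<And>i. i \<in> I \<Longrightarrow> I \<lesssim> S i"
  shows "\<exists>T. \<forall>i\<in>I. S i \<inter> T \<noteq> {} \<and> S i - T \<noteq> {}"
proof -
  have "I \<times> (UNIV :: bool set) \<lesssim> S i" if "i \<in> I" for i
  proof -
    have "(UNIV :: bool set) \<lesssim> S i"
      using infinite[OF that] by (simp add: finite_lepoll_infinite)
    then have "I \<times> (UNIV :: bool set) \<lesssim> S i \<times> S i"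
      by (intro times_lepoll_mono lepoll[OF that])
    also have "S i \<times> S i \<approx> S i"
      using infinite[OF that] by (simp add: eqpoll_iff_card_of_ordIso card_of_Times_same_infinite)
    finally show ?thesis .
  qed
  then have "\<exists>f. inj_on f (I \<times> (UNIV :: bool set)) \<and> (\<forall>j\<in>I \<times> UNIV. f j \<in> S (fst j))"
    by (intro inj_on_choice_function) auto
  then obtain f where inj: "inj_on f (I \<times> (UNIV :: bool set))"
    and choice: "\<And>i u. i \<in> I \<Longrightarrow> f (i, u) \<in> S i"
    by fastforce
  define T where "T = (\<lambda>i. f (i, True)) ` I"
  have "f (i, False) \<notin> T" if "i \<in> I" for i
    using inj that by (auto simp: T_def dest: inj_onD)
  moreover have "f (i, True) \<in> T" if "i \<in> I" for i
    using that by (simp add: T_def)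
  ultimately have "\<forall>i\<in>I. S i \<inter> T \<noteq> {} \<and> S i - T \<noteq> {}"
    using choice by blast
  then show ?thesis ..
qed

lemma dependent_binary_tree_choice:
  assumes root: "P p0"
    and split: "\<And>p. P p \<Longrightarrow> \<exists>q q'. P q \<and> P q' \<and> R p q \<and> R p q' \<and> C q q'"
    and sym: "symp C"
  shows "\<exists>T :: nat set \<Rightarrow> nat \<Rightarrow> 'p. (\<forall>x. T x 0 = p0) \<and>
    (\<forall>x n. P (T x n) \<and> R (T x n) (T x (Suc n))) \<and> (\<forall>x y. x \<noteq> y \<longrightarrow> (\<exists>n. C (T x n) (T y n)))"
proof -
  obtain l r where succ: "\<And>p. P p \<Longrightarrow> P (l p) \<and> P (r p) \<and> R p (l p) \<and> R p (r p) \<and> C (l p) (r p)"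
    using split by metis
  define T where "T x = rec_nat p0 (\<lambda>n p. if n \<in> x then l p else r p)" for x :: "nat set"
  have T_0: "T x 0 = p0" and T_Suc: "T x (Suc n) = (if n \<in> x then l (T x n) else r (T x n))" for x n
    by (simp_all add: T_def)
  have T_P: "P (T x n)" for x n
    by (induction n) (use root succ in \<open>auto simp: T_0 T_Suc\<close>)
  have T_R: "R (T x n) (T x (Suc n))" for x n
    using succ[OF T_P] by (simp add: T_Suc)
  have T_branch: "\<exists>n. C (T x n) (T y n)" if "x \<noteq> y" for x y
  proof -
    have "\<exists>n. (n \<in> x) \<noteq> (n \<in> y)"
      using that by blast
    then obtain n where differ: "(n \<in> x) \<noteq> (n \<in> y)" and agree: "\<And>m. m < n \<Longrightarrow> (m \<in> x) = (m \<in> y)"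
      using exists_least_iff[of "\<lambda>n. (n \<in> x) \<noteq> (n \<in> y)"] by blast
    have "T x m = T y m" if "m \<le> n" for m
      using that by (induction m) (simp_all add: T_0 T_Suc agree)
    then have "T x n = T y n"
      by simp
    then have "C (T x (Suc n)) (T y (Suc n))"
      using succ[OF T_P] differ sympD[OF sym] by (auto simp: T_Suc)
    then show ?thesis ..
  qed
  show ?thesis
    by (intro exI[of _ T] conjI allI impI T_0 T_P T_R T_branch)
qed

section \<open>Sigma-ideals\<close>

lemma partition_on_lepoll:
  assumes "partition_on A P"
  shows "P \<lesssim> A"
proof (rule lepoll_relational_full[where R = "(\<in>)"])
  show "\<exists>x. x \<in> A \<and> x \<in> F" if "F \<in> P" for F
    using that assms unfolding partition_on_def by (metis UnionI ex_in_conv)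
  show "F = G" if "x \<in> A" "F \<in> P" "x \<in> F" "G \<in> P" "x \<in> G" for x F G
    using that partition_onD2[OF assms] by (auto simp: disjoint_def)
qed

locale sigma_ideal =
  fixes small :: "'a set \<Rightarrow> bool"
  assumes small_subset: "small N \<Longrightarrow> N' \<subseteq> N \<Longrightarrow> small N'"
    and small_Union: "countable \<N> \<Longrightarrow> (\<And>N. N \<in> \<N> \<Longrightarrow> small N) \<Longrightarrow> small (\<Union>\<N>)"
begin

text \<open>Indices are coded by subsets of \<open>\<nat>\<close>. If nothing splits, discarding for each \<open>n\<close> the small half
  of the indices, according to whether \<open>n\<close> belongs to their code, leaves at most one index.\<close>

lemma exists_nonsmall_split:
  fixes N :: "'i \<Rightarrow> 'a set"
  assumes continuum: "I \<lesssim> (UNIV :: nat set set)"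
    and small: "\<And>i. i \<in> I \<Longrightarrow> small (N i)" and nonsmall: "\<not> small (\<Union>i\<in>I. N i)"
  shows "\<exists>J\<subseteq>I. \<not> small (\<Union>i\<in>J. N i) \<and> \<not> small (\<Union>i\<in>I - J. N i)"
proof (rule ccontr)
  assume no_split: "\<not> ?thesis"
  obtain code :: "'i \<Rightarrow> nat set" where code: "inj_on code I"
    using continuum by (auto simp: lepoll_def)
  define digit where "digit n = {i \<in> I. n \<in> code i}" for n
  define G where "G n = (if small (\<Union>i\<in>digit n. N i) then digit n else I - digit n)" for n
  have small_G: "small (\<Union>i\<in>G n. N i)" for n
  proof -
    have "digit n \<subseteq> I"
      by (auto simp: digit_def)
    then show ?thesis
      using no_split by (auto simp: G_def)
  qed
  define R where "R = I - (\<Union>n. G n)"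
  have "i = j" if "i \<in> R" "j \<in> R" for i j
  proof -
    have "n \<in> code i \<longleftrightarrow> n \<in> code j" for n
      using that by (auto simp: R_def G_def digit_def split: if_splits)
    then have "code i = code j"
      by blast
    then show ?thesis
      using code that by (auto simp: R_def dest: inj_onD)
  qed
  then have "countable R"
    by (intro countableI'[of "\<lambda>_. ()"] inj_onI)
  then have "small (\<Union>(N ` R \<union> range (\<lambda>n. \<Union>i\<in>G n. N i)))"
    using small small_G by (intro small_Union) (auto simp: R_def)
  moreover have "(\<Union>i\<in>I. N i) \<subseteq> \<Union>(N ` R \<union> range (\<lambda>n. \<Union>i\<in>G n. N i))"
    by (auto simp: R_def)
  ultimately show False
    using nonsmall small_subset by blast
qed

end

section \<open>Mathias conditions and fusion\<close>

definition Mathias_condition :: "nat set \<times> nat set \<Rightarrow> bool" where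
  "Mathias_condition p \<longleftrightarrow> finite (fst p) \<and> infinite (snd p)"

definition strictly_extended_by :: "nat set \<times> nat set \<Rightarrow> nat set \<times> nat set \<Rightarrow> bool" where
  "strictly_extended_by p q \<longleftrightarrow> fst p \<subset> fst q \<and> fst q \<union> snd q \<subseteq> fst p \<union> snd p"

definition nbhd :: "nat set \<times> nat set \<Rightarrow> nat set set" where
  "nbhd p = ellentuck_basic (fst p) (snd p)"

definition conditions_within :: "nat set set \<Rightarrow> (nat set \<times> nat set) set" where
  "conditions_within M = {p. Mathias_condition p \<and> nbhd p \<subseteq> M}"

lemma nbhd_Pair [simp]: "nbhd (a, A) = ellentuck_basic a A"
  by (simp add: nbhd_def)

lemma ellentuck_basic_mono:
  "a \<subseteq> a' \<Longrightarrow> a' \<union> A' \<subseteq> a \<union> A \<Longrightarrow> ellentuck_basic a' A' \<subseteq> ellentuck_basic a A"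
  unfolding ellentuck_basic_def by auto

lemma fusion_mem_nbhd:
  assumes cond: "\<And>n. Mathias_condition (p n)" and ext: "\<And>n. strictly_extended_by (p n) (p (Suc n))"
  shows "(\<Union>n. fst (p n)) \<in> nbhd (p m)"
proof -
  have strict: "strict_mono (fst \<circ> p)"
    using ext by (simp add: strict_mono_Suc_iff strictly_extended_by_def)
  have "fst (p (Suc n)) \<union> snd (p (Suc n)) \<subseteq> fst (p n) \<union> snd (p n)" for n
    using ext by (simp add: strictly_extended_by_def)
  then have antimono: "fst (p n) \<union> snd (p n) \<subseteq> fst (p m) \<union> snd (p m)" if "m \<le> n" for m n
    using that by (rule lift_Suc_antimono_le)
  have "inj (fst \<circ> p)"
    using strict by (rule strict_mono_imp_inj_on)
  then have "infinite (range (fst \<circ> p))"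
    by (rule range_inj_infinite)
  then have "infinite (\<Union>(range (fst \<circ> p)))"
    using finite_UnionD by blast
  moreover have "fst (p n) \<subseteq> fst (p m) \<union> snd (p m)" for n
  proof (cases "n \<le> m")
    case True
    then show ?thesis
      using strict_mono_leD[OF strict, of n m] by auto
  next
    case False
    then show ?thesis
      using antimono[of m n] by auto
  qed
  ultimately show ?thesis
    by (auto simp: nbhd_def ellentuck_basic_def inf_subsets_def)
qed

section \<open>Nowhere Ramsey sets\<close>

lemma nowhere_Ramsey_subset: "nowhere_Ramsey N \<Longrightarrow> N' \<subseteq> N \<Longrightarrow> nowhere_Ramsey N'"
  unfolding nowhere_Ramsey_def by (meson disjoint_iff subsetD)

lemma large_nbhd:
  assumes "Mathias_condition p"
  shows "large (nbhd p)"
  unfolding large_def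
proof
  assume "nowhere_Ramsey (nbhd p)"
  then obtain B where infinite_subset: "B \<subseteq> snd p" "infinite B"
    and disjoint: "ellentuck_basic (fst p) B \<inter> nbhd p = {}"
    using assms unfolding nowhere_Ramsey_def Mathias_condition_def inf_subsets_def by blast
  have "fst p \<union> B \<in> ellentuck_basic (fst p) B \<inter> nbhd p"
    using infinite_subset by (auto simp: nbhd_def ellentuck_basic_def inf_subsets_def)
  with disjoint show False
    by blast
qed

lemma nowhere_Ramsey_avoid_stems:
  assumes NR: "nowhere_Ramsey N" and "finite \<S>" "\<And>a. a \<in> \<S> \<Longrightarrow> finite a" and "infinite A"
  shows "\<exists>B\<in>inf_subsets A. \<forall>a\<in>\<S>. ellentuck_basic a B \<inter> N = {}"
  using assms(2-)
proof (induction \<S>)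
  case empty
  then show ?case
    by (auto simp: inf_subsets_def)
next
  case (insert a \<S>)
  then obtain B where B: "B \<subseteq> A" "infinite B"
    and avoid_\<S>: "\<forall>b\<in>\<S>. ellentuck_basic b B \<inter> N = {}"
    unfolding inf_subsets_def by auto
  have "finite a"
    using insert.prems by simp
  then obtain C where C: "C \<subseteq> B" "infinite C" and avoid_a: "ellentuck_basic a C \<inter> N = {}"
    using NR B(2) unfolding nowhere_Ramsey_def inf_subsets_def by blast
  have "ellentuck_basic b C \<subseteq> ellentuck_basic b B" for b
    using C(1) by (intro ellentuck_basic_mono) auto
  then have "\<forall>b\<in>insert a \<S>. ellentuck_basic b C \<inter> N = {}"
    using avoid_\<S> avoid_a by blast
  moreover have "C \<in> inf_subsets A"
    using B(1) C by (auto simp: inf_subsets_def)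
  ultimately show ?case
    by blast
qed

lemma nowhere_Ramsey_avoiding_extension:
  assumes NR: "nowhere_Ramsey N" and cond: "Mathias_condition p"
  shows "\<exists>q. Mathias_condition q \<and> strictly_extended_by p q \<and>
    (\<forall>t\<subseteq>fst q. ellentuck_basic t (snd q) \<inter> N = {})"
proof -
  obtain k where k: "k \<in> snd p" "k \<notin> fst p"
    using cond by (meson Mathias_condition_def finite_subset subsetI)
  define b where "b = insert k (fst p)"
  have "finite b"
    using cond by (simp add: b_def Mathias_condition_def)
  then obtain B where "B \<in> inf_subsets (snd p)" "\<forall>t\<in>Pow b. ellentuck_basic t B \<inter> N = {}"
    using nowhere_Ramsey_avoid_stems[OF NR, of "Pow b" "snd p"] cond
    by (auto simp: Mathias_condition_def dest: finite_subset)
  then show ?thesis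
    using k \<open>finite b\<close>
    by (intro exI[of _ "(b, B)"])
      (auto simp: b_def Mathias_condition_def strictly_extended_by_def inf_subsets_def)
qed

lemma nowhere_Ramsey_UN:
  fixes N :: "nat \<Rightarrow> nat set set"
  assumes NR: "\<And>n. nowhere_Ramsey (N n)"
  shows "nowhere_Ramsey (\<Union>n. N n)"
  unfolding nowhere_Ramsey_def
proof (intro allI impI, elim conjE)
  fix a A :: "nat set" assume cond: "finite a" "infinite A"
  define avoids where "avoids n q \<longleftrightarrow> (\<forall>t\<subseteq>fst q. ellentuck_basic t (snd q) \<inter> N n = {})" for n q
  have "\<exists>p. \<forall>n. (Mathias_condition (p n) \<and> (n = 0 \<longrightarrow> p n = (a, A))) \<and>
      strictly_extended_by (p n) (p (Suc n)) \<and> avoids n (p (Suc n))"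
    using nowhere_Ramsey_avoiding_extension[OF NR] cond
    by (intro dependent_nat_choice) (auto simp: Mathias_condition_def avoids_def)
  then obtain p where p_cond: "\<And>n. Mathias_condition (p n)" and p_0: "p 0 = (a, A)"
    and p_extends: "\<And>n. strictly_extended_by (p n) (p (Suc n))"
    and avoids: "\<And>n. avoids n (p (Suc n))"
    by blast
  define D where "D = (\<Union>n. fst (p n))"
  have D_nbhd: "D \<in> nbhd (p n)" for n
    unfolding D_def using p_cond p_extends by (rule fusion_mem_nbhd)
  have D_basic: "a \<subseteq> D" "D \<subseteq> a \<union> A" "infinite D"
    using D_nbhd[of 0] p_0 by (auto simp: ellentuck_basic_def inf_subsets_def)
  have "X \<notin> N n" if "X \<in> ellentuck_basic a (D \<inter> A)" for X n
  proof -
    have "X \<in> ellentuck_basic (X \<inter> fst (p (Suc n))) (snd (p (Suc n)))"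
      using that D_nbhd[of "Suc n"] D_basic(1) unfolding nbhd_def ellentuck_basic_def by blast
    then show ?thesis
      using avoids[of n] unfolding avoids_def by blast
  qed
  moreover have "infinite (D \<inter> A)"
    using D_basic cond(1) by (metis Int_Un_distrib finite_Int finite_Un inf.absorb_iff1)
  ultimately show "\<exists>B\<in>inf_subsets A. ellentuck_basic a B \<inter> (\<Union>n. N n) = {}"
    unfolding inf_subsets_def by blast
qed

interpretation nowhere_Ramsey: sigma_ideal nowhere_Ramsey
proof
  fix \<N> :: "nat set set set"
  assume countable: "countable \<N>" and N: "\<And>N. N \<in> \<N> \<Longrightarrow> nowhere_Ramsey N"
  have "nowhere_Ramsey {}"
    by (auto simp: nowhere_Ramsey_def inf_subsets_def)
  then have "nowhere_Ramsey (from_nat_into (insert {} \<N>) n)" for n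
    using N from_nat_into[of "insert {} \<N>" n] by auto
  then have "nowhere_Ramsey (\<Union>n. from_nat_into (insert {} \<N>) n)"
    by (rule nowhere_Ramsey_UN)
  then show "nowhere_Ramsey (\<Union>\<N>)"
    using countable by (simp add: range_from_nat_into)
qed (rule nowhere_Ramsey_subset)

lemma completely_Ramsey_large_contains_nbhd:
  assumes CR: "completely_Ramsey N" and large: "large (N \<inter> nbhd p)" and cond: "Mathias_condition p"
  shows "\<exists>q. Mathias_condition q \<and> strictly_extended_by p q \<and> nbhd q \<subseteq> N"
proof -
  obtain c C where "finite c" "infinite C"
    and meets: "\<And>B. B \<in> inf_subsets C \<Longrightarrow> ellentuck_basic c B \<inter> (N \<inter> nbhd p) \<noteq> {}"
    using large unfolding large_def nowhere_Ramsey_def by blast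
  then obtain B where B: "B \<in> inf_subsets C" and
    "ellentuck_basic c B \<subseteq> N \<or> ellentuck_basic c B \<inter> N = {}"
    using CR unfolding completely_Ramsey_def by blast
  then have sub: "ellentuck_basic c B \<subseteq> N"
    using meets by blast
  obtain X where "X \<in> ellentuck_basic c B" "X \<in> nbhd p"
    using meets[OF B] by blast
  then have X_bounds: "c \<subseteq> X" "X \<subseteq> c \<union> B" "fst p \<subseteq> X" "X \<subseteq> fst p \<union> snd p"
    and "infinite X"
    by (auto simp: nbhd_def ellentuck_basic_def inf_subsets_def)
  obtain k where k: "k \<in> X" "k \<notin> fst p"
    using \<open>infinite X\<close> cond by (meson Mathias_condition_def finite_subset subsetI)
  define b where "b = insert k (fst p \<union> c)"
  have "ellentuck_basic b X \<subseteq> ellentuck_basic c B"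
    using X_bounds k by (intro ellentuck_basic_mono) (auto simp: b_def)
  then show ?thesis
    using X_bounds k cond sub \<open>infinite X\<close> \<open>finite c\<close>
    by (intro exI[of _ "(b, X)"]) (auto simp: b_def Mathias_condition_def strictly_extended_by_def)
qed

section \<open>Kuratowski partitions into nowhere Ramsey sets\<close>

locale NR_Kuratowski_partition =
  fixes M :: "nat set set" and \<F> :: "nat set set set"
  assumes partition: "partition_on M \<F>"
    and nowhere_Ramsey_part: "F \<in> \<F> \<Longrightarrow> nowhere_Ramsey F"
    and completely_Ramsey_Union: "\<G> \<subseteq> \<F> \<Longrightarrow> completely_Ramsey (\<Union>\<G>)"
begin

definition parts_meeting :: "nat set set \<Rightarrow> nat set set set" where
  "parts_meeting E = {F \<in> \<F>. F \<inter> E \<noteq> {}}"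

lemma parts_meeting_subset:
  assumes "\<G> \<subseteq> \<F>" "E \<subseteq> \<Union>\<G>"
  shows "parts_meeting E \<subseteq> \<G>"
proof
  fix F assume "F \<in> parts_meeting E"
  then obtain X G where "F \<in> \<F>" "X \<in> F" "G \<in> \<G>" "X \<in> G"
    using assms(2) unfolding parts_meeting_def by blast
  then show "F \<in> \<G>"
    using disjointD[OF partition_onD2[OF partition], of F G] assms(1) by blast
qed

lemma exists_subfamily_large_colarge:
  assumes "p \<in> conditions_within M"
  shows "\<exists>\<G>\<subseteq>\<F>. large (\<Union>\<G> \<inter> nbhd p) \<and> large (\<Union>(\<F> - \<G>) \<inter> nbhd p)"
proof -
  have cond: "Mathias_condition p" and sub: "nbhd p \<subseteq> M"
    using assms by (simp_all add: conditions_within_def)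
  have "\<F> \<lesssim> (UNIV :: nat set set)"
    using partition_on_lepoll[OF partition] subset_imp_lepoll[OF subset_UNIV] by (rule lepoll_trans)
  moreover have "nowhere_Ramsey (F \<inter> nbhd p)" if "F \<in> \<F>" for F
    using nowhere_Ramsey_part[OF that] by (rule nowhere_Ramsey_subset) simp
  moreover have "(\<Union>F\<in>\<F>. F \<inter> nbhd p) = nbhd p"
    using sub partition_onD1[OF partition] by blast
  then have "\<not> nowhere_Ramsey (\<Union>F\<in>\<F>. F \<inter> nbhd p)"
    using large_nbhd[OF cond] by (simp add: large_def)
  ultimately have "\<exists>\<G>\<subseteq>\<F>. \<not> nowhere_Ramsey (\<Union>F\<in>\<G>. F \<inter> nbhd p) \<and>
      \<not> nowhere_Ramsey (\<Union>F\<in>\<F> - \<G>. F \<inter> nbhd p)"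
    by (rule nowhere_Ramsey.exists_nonsmall_split)
  then show ?thesis
    by (simp add: large_def)
qed

definition separated :: "nat set \<times> nat set \<Rightarrow> nat set \<times> nat set \<Rightarrow> bool" where
  "separated p q \<longleftrightarrow> disjnt (parts_meeting (nbhd p)) (parts_meeting (nbhd q))"

lemma exists_separated_extensions:
  assumes "p \<in> conditions_within M"
  shows "\<exists>q q'. q \<in> conditions_within M \<and> q' \<in> conditions_within M \<and>
    strictly_extended_by p q \<and> strictly_extended_by p q' \<and> separated q q'"
proof -
  have cond: "Mathias_condition p"
    using assms by (simp add: conditions_within_def)
  obtain \<G> where \<G>: "\<G> \<subseteq> \<F>" "large (\<Union>\<G> \<inter> nbhd p)" "large (\<Union>(\<F> - \<G>) \<inter> nbhd p)"
    using exists_subfamily_large_colarge[OF assms] by blast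
  obtain q where q: "Mathias_condition q" "strictly_extended_by p q" "nbhd q \<subseteq> \<Union>\<G>"
    using completely_Ramsey_large_contains_nbhd[OF completely_Ramsey_Union \<G>(2) cond] \<G>(1) by blast
  obtain q' where q': "Mathias_condition q'" "strictly_extended_by p q'" "nbhd q' \<subseteq> \<Union>(\<F> - \<G>)"
    using completely_Ramsey_large_contains_nbhd[OF completely_Ramsey_Union \<G>(3) cond] by blast
  have "parts_meeting (nbhd q) \<subseteq> \<G>" "parts_meeting (nbhd q') \<subseteq> \<F> - \<G>"
    using parts_meeting_subset q(3) q'(3) \<G>(1) by blast+
  then have "separated q q'"
    by (auto simp: separated_def disjnt_def)
  moreover have "nbhd q \<subseteq> M" "nbhd q' \<subseteq> M"
    using q(3) q'(3) \<G>(1) partition_onD1[OF partition] by blast+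
  ultimately show ?thesis
    using q(1,2) q'(1,2) unfolding conditions_within_def by blast
qed

lemma continuum_lepoll_parts_meeting:
  assumes "p \<in> conditions_within M"
  shows "(UNIV :: nat set set) \<lesssim> parts_meeting (nbhd p)"
proof -
  have "symp separated"
    by (auto simp: symp_def separated_def disjnt_iff)
  then obtain T :: "nat set \<Rightarrow> nat \<Rightarrow> nat set \<times> nat set" where T_0: "\<And>x. T x 0 = p"
    and T_within: "\<And>x n. T x n \<in> conditions_within M"
    and T_extends: "\<And>x n. strictly_extended_by (T x n) (T x (Suc n))"
    and T_separated: "\<And>x y. x \<noteq> y \<Longrightarrow> \<exists>n. separated (T x n) (T y n)"
    using dependent_binary_tree_choice[where P = "\<lambda>q. q \<in> conditions_within M" and
        R = strictly_extended_by and C = separated, OF assms exists_separated_extensions] by blast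
  define limit where "limit x = (\<Union>n. fst (T x n))" for x
  have limit: "limit x \<in> nbhd (T x n)" for x n
    unfolding limit_def using T_within T_extends
    by (intro fusion_mem_nbhd) (auto simp: conditions_within_def)
  have "\<exists>F\<in>\<F>. limit x \<in> F" for x
    using limit[of x 0] T_within[of x 0] partition_onD1[OF partition]
    unfolding conditions_within_def by blast
  then obtain part where "\<And>x. part x \<in> \<F>" "\<And>x. limit x \<in> part x"
    by metis
  then have part: "part x \<in> parts_meeting (nbhd (T x n))" for x n
    using limit[of x n] by (auto simp: parts_meeting_def)
  have "inj part"
  proof (rule injI, rule ccontr)
    fix x y assume "part x = part y" "x \<noteq> y"
    with T_separated[of x y] part show False
      by (metis separated_def disjnt_iff)
  qed
  moreover have "range part \<subseteq> parts_meeting (nbhd p)"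
    using part[of _ 0] by (auto simp: T_0)
  ultimately show ?thesis
    by (auto simp: lepoll_def)
qed

lemma nbhd_not_subset:
  assumes "Mathias_condition p"
  shows "\<not> nbhd p \<subseteq> M"
proof
  assume sub: "nbhd p \<subseteq> M"
  obtain a A where p: "p = (a, A)" and cond: "finite a" "infinite A"
    using assms by (cases p) (auto simp: Mathias_condition_def)
  define S where "S B = parts_meeting (ellentuck_basic a B)" for B
  have continuum: "(UNIV :: nat set set) \<lesssim> S B" if B: "B \<in> inf_subsets A" for B
  proof -
    have "ellentuck_basic a B \<subseteq> ellentuck_basic a A"
      using B by (intro ellentuck_basic_mono) (auto simp: inf_subsets_def)
    then show ?thesis
      using continuum_lepoll_parts_meeting[of "(a, B)"] cond B sub
      by (auto simp: S_def p conditions_within_def Mathias_condition_def inf_subsets_def)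
  qed
  have "infinite (S B)" if "B \<in> inf_subsets A" for B
    using continuum[OF that] lepoll_Pow_self[of "UNIV :: nat set"]
    by (metis Pow_UNIV infinite_le_lepoll lepoll_trans)
  moreover have "inf_subsets A \<lesssim> S B" if "B \<in> inf_subsets A" for B
    using subset_imp_lepoll[OF subset_UNIV] continuum[OF that] by (rule lepoll_trans)
  ultimately obtain \<T> where splitting: "\<And>B. B \<in> inf_subsets A \<Longrightarrow> S B \<inter> \<T> \<noteq> {} \<and> S B - \<T> \<noteq> {}"
    using exists_splitting_set[of "inf_subsets A" S] by blast
  obtain B where B: "B \<in> inf_subsets A"
    and homogeneous: "ellentuck_basic a B \<subseteq> \<Union>(\<F> \<inter> \<T>) \<or> ellentuck_basic a B \<inter> \<Union>(\<F> \<inter> \<T>) = {}"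
    using completely_Ramsey_Union[of "\<F> \<inter> \<T>"] cond unfolding completely_Ramsey_def by blast
  from homogeneous show False
  proof
    assume "ellentuck_basic a B \<subseteq> \<Union>(\<F> \<inter> \<T>)"
    then have "S B \<subseteq> \<F> \<inter> \<T>"
      unfolding S_def by (intro parts_meeting_subset) auto
    then show False
      using splitting[OF B] by blast
  next
    assume "ellentuck_basic a B \<inter> \<Union>(\<F> \<inter> \<T>) = {}"
    then show False
      using splitting[OF B] by (auto simp: S_def parts_meeting_def)
  qed
qed

lemma not_large:
  assumes "M \<subseteq> inf_subsets UNIV"
  shows "\<not> large M"
proof
  assume "large M"
  moreover have "nbhd ({}, UNIV) = inf_subsets UNIV"
    by (auto simp: ellentuck_basic_def)
  ultimately have "large (M \<inter> nbhd ({}, UNIV))"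
    using assms by (simp add: Int_absorb2)
  moreover have "completely_Ramsey M"
    using completely_Ramsey_Union[of \<F>] partition_onD1[OF partition] by simp
  moreover have "Mathias_condition ({}, UNIV)"
    by (simp add: Mathias_condition_def)
  ultimately show False
    using completely_Ramsey_large_contains_nbhd nbhd_not_subset by blast
qed

end

theorem theorem2:
  fixes M :: "nat set set"
  assumes "M \<subseteq> inf_subsets UNIV"
    and "EL_open M"
    and "large M"
  shows "\<not> (\<exists>\<F>. large_NR_partition M \<F> \<and> EL_dense M \<F> \<and> Kuratowski_partition M \<F>)"
proof
  assume "\<exists>\<F>. large_NR_partition M \<F> \<and> EL_dense M \<F> \<and> Kuratowski_partition M \<F>"
  then obtain \<F> where "large_NR_partition M \<F>" "Kuratowski_partition M \<F>"
    by blast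
  then have "NR_Kuratowski_partition M \<F>"
    by (simp add: NR_Kuratowski_partition_def large_NR_partition_def Kuratowski_partition_def)
  then show False
    using NR_Kuratowski_partition.not_large assms(1,3) by blast
qed

end
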